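(* For all $p\in[0,1]$ with $p<p_0$, one has $v_p=0$, where $v_p$ is the almost sure constant value of the game on $\mathbb L$ with i.i.d. Bernoulli($p$) edge costs and $p_0$ is the critical point for the existence of a $0$-path.
   Context: Graph. $\mathbb L=\{(x,y)\in\mathbb Z^2: x+y \text{ is even}\}$, with an edge between two points exactly when they are at Euclidean distance $\sqrt2$. $E$ is the set of (non-oriented) edges. Each edge $e$ carries a cost $c(e)$; the $(c(e))_{e\in E}$ are i.i.d. Bernoulli random variables with parameter $p\in[0,1]$; the law is $\mathbb P_p$. $0$-squares and $0$-paths. The squares (faces) of $\mathbb L$ are identified with their centers, i.e. the points $(x,y)\in\mathbb Z^2$ with $x+y$ odd; the square centered at $(x,y)$ has corners $(x\pm1,y),(x,y\pm1)$ and is composed of the four edges of $\mathbb L$ joining these corners cyclically. A square is a $0$-square if its four edges all have cost $0$. A $0$-path is an infinite (in both directions) horizontal path of $0$-squares, i.e. a sequence of centers $(i,y_i)_{i\in\mathbb Z}$ with $i+y_i$ odd and $|y_{i+1}-y_i|=1$ for all $i\in\mathbb Z$ (consecutive squares share an edge), such that every square centered at $(i,y_i)$ is a $0$-square. The critical point is $p_0=\sup\{p\in[0,1]:\mathbb P_p(\text{there exists a }0\text{-path})>0\}$. Game. For a fixed realization of $(c(e))_{e\in E}$ (known to both players from the start) and $z\in\mathbb L$, the zero-sum game $\Gamma(z)$ is as follows. A token is placed at $z$. At each stage $m\ge1$, Player 1 selects an action in $\{T,B\}$ and announces it; then Player 2 selects an action in $\{L,R\}$. If the token is at $(x,y)$,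 it moves to $(x+1,y+1)$ if $(T,R)$ is played, to $(x-1,y+1)$ if $(T,L)$, to $(x+1,y-1)$ if $(B,R)$, to $(x-1,y-1)$ if $(B,L)$. Let $e_m$ be the edge crossed at stage $m$. The history at stage $m$ is $(e_1,\dots,e_{m-1})$, and $H=\bigcup_{m\ge1}E^{m-1}$. A strategy of Player 1 is a map $\sigma:H\to\{T,B\}$; a strategy of Player 2 is a map $\tau:H\to\{L,R\}^2$, whose first (resp. second) component is the action played when Player 1 plays $T$ (resp. $B$) at that stage. The sets of strategies are $\Sigma$ and $\mathcal T$. Player 1 minimizes and Player 2 maximizes the total cost $\gamma(z,\sigma,\tau)=\limsup_{n\to+\infty}\frac1n\sum_{m=1}^n c(e_m)$. The game has a value $v(z)=\inf_{\sigma\in\Sigma}\sup_{\tau\in\mathcal T}\gamma(z,\sigma,\tau)=\sup_{\tau\in\mathcal T}\inf_{\sigma\in\Sigma}\gamma(z,\sigma,\tau)$. For each $p$ there is a constant $v_p\in[0,1]$ such that $\mathbb P_p$-almost surely $v(z)=v_p$ for all $z\in\mathbb L$; this defines $v_p$. *)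

theory Defs
  imports "HOL-Probability.Probability"
begin

type_synonym point = "int \<times> int"
type_synonym edge = "point set"

definition lattice :: "point set" where
  "lattice = {(x, y). even (x + y)}"

definition embed :: "point \<Rightarrow> real \<times> real" where
  "embed q = (of_int (fst q), of_int (snd q))"

text \<open>The metric on \<open>real \<times> real\<close> is the Euclidean one.\<close>

definition edges :: "edge set" where
  "edges = {{a, b} | a b. a \<in> lattice \<and> b \<in> lattice \<and> dist (embed a) (embed b) = sqrt 2}"

definition cost_law :: "real \<Rightarrow> (edge \<Rightarrow> real) measure" where
  "cost_law p = PiM edges (\<lambda>_. measure_pmf (map_pmf of_bool (bernoulli_pmf p)))"

text \<open>Squares are represented by their centers, the points \<open>(x, y)\<close> with \<open>x + y\<close> odd.\<close>

definition square_edges :: "point \<Rightarrow> edge set" where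
  "square_edges s = (case s of (x, y) \<Rightarrow>
     {{(x + 1, y), (x, y + 1)}, {(x, y + 1), (x - 1, y)},
      {(x - 1, y), (x, y - 1)}, {(x, y - 1), (x + 1, y)}})"

definition zero_square :: "(edge \<Rightarrow> real) \<Rightarrow> point \<Rightarrow> bool" where
  "zero_square c s \<longleftrightarrow> (\<forall>e \<in> square_edges s. c e = 0)"

definition zero_path :: "(edge \<Rightarrow> real) \<Rightarrow> (int \<Rightarrow> int) \<Rightarrow> bool" where
  "zero_path c y \<longleftrightarrow>
     (\<forall>i. odd (i + y i) \<and> \<bar>y (i + 1) - y i\<bar> = 1 \<and> zero_square c (i, y i))"

definition p_crit :: real where
  "p_crit = Sup {p \<in> {0..1}.
     measure (cost_law p) {c \<in> space (cost_law p). \<exists>y. zero_path c y} > 0}"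

datatype vaction = Top | Bottom
datatype haction = Left | Right

text \<open>Strategies are total functions on lists of edges in chronological order; only their values
  on \<open>lists edges\<close> can influence a play that starts in \<^const>\<open>lattice\<close>.\<close>

type_synonym strategy1 = "edge list \<Rightarrow> vaction"
type_synonym strategy2 = "edge list \<Rightarrow> haction \<times> haction"

fun move :: "point \<Rightarrow> vaction \<Rightarrow> haction \<Rightarrow> point" where
  "move (x, y) Top Right = (x + 1, y + 1)"
| "move (x, y) Top Left = (x - 1, y + 1)"
| "move (x, y) Bottom Right = (x + 1, y - 1)"
| "move (x, y) Bottom Left = (x - 1, y - 1)"

definition reply :: "haction \<times> haction \<Rightarrow> vaction \<Rightarrow> haction" where
  "reply r a = (case a of Top \<Rightarrow> fst r | Bottom \<Rightarrow> snd r)"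

text \<open>Token position and history after a given number of stages.\<close>

primrec play :: "point \<Rightarrow> strategy1 \<Rightarrow> strategy2 \<Rightarrow> nat \<Rightarrow> point \<times> edge list" where
  "play z \<sigma> \<tau> 0 = (z, [])"
| "play z \<sigma> \<tau> (Suc n) =
     (let (q, h) = play z \<sigma> \<tau> n; q' = move q (\<sigma> h) (reply (\<tau> h) (\<sigma> h))
      in (q', h @ [{q, q'}]))"

text \<open>The edge crossed at stage \<open>m \<ge> 1\<close>.\<close>

definition crossed_edge :: "point \<Rightarrow> strategy1 \<Rightarrow> strategy2 \<Rightarrow> nat \<Rightarrow> edge" where
  "crossed_edge z \<sigma> \<tau> m = {fst (play z \<sigma> \<tau> (m - 1)), fst (play z \<sigma> \<tau> m)}"

definition total_cost :: "(edge \<Rightarrow> real) \<Rightarrow> point \<Rightarrow> strategy1 \<Rightarrow> strategy2 \<Rightarrow> ereal" where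
  "total_cost c z \<sigma> \<tau> =
     limsup (\<lambda>n. ereal ((1 / real n) * (\<Sum>m = 1..n. c (crossed_edge z \<sigma> \<tau> m))))"

definition has_value :: "(edge \<Rightarrow> real) \<Rightarrow> point \<Rightarrow> real \<Rightarrow> bool" where
  "has_value c z v \<longleftrightarrow>
     (INF \<sigma>. SUP \<tau>. total_cost c z \<sigma> \<tau>) = ereal v \<and>
     (SUP \<tau>. INF \<sigma>. total_cost c z \<sigma> \<tau>) = ereal v"

definition is_as_value :: "real \<Rightarrow> real \<Rightarrow> bool" where
  "is_as_value p v \<longleftrightarrow>
     v \<in> {0..1} \<and> (AE c in cost_law p. \<forall>z \<in> lattice. has_value c z v)"

definition as_value :: "real \<Rightarrow> real" where
  "as_value p = (THE v. is_as_value p v)"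

end

theory Submission
  imports Defs
begin

text \<open>Below the critical point a zero path exists with positive probability: multiplying the costs by
  independent Bernoulli variables couples a smaller parameter to a larger one and can only create zero
  edges. By a zero-one law for vertical shifts a zero path then exists almost surely.

  Player 1 moves vertically towards such a path, whatever Player 2 does. The vertical distance to the
  path is odd and never increases. Once it is 1, the token stays on corners of the squares of the
  path, entering and leaving them along edges of cost 0. If it stabilised at a larger value, the token
  and the path would both run along a diagonal forever in one direction, which gives a diagonal ray of
  edges of cost 0; for \<open>p > 0\<close> such a ray almost surely does not exist.\<close>

section \<open>Zero paths as limits of finite paths\<close>

text \<open>Half a zero path cut off after \<open>n\<close> steps, running right for
  \<open>s = 1\<close> and left for \<open>s = -1\<close>. Such an event involves only finitely many
  costs; measurability and independence are proved at this level and carried to whole zero paths by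
  limits.\<close>

fun reach :: "int \<Rightarrow> nat \<Rightarrow> (edge \<Rightarrow> real) \<Rightarrow> point \<Rightarrow> bool" where
  "reach s 0 c (x, y) \<longleftrightarrow> odd (x + y) \<and> zero_square c (x, y)"
| "reach s (Suc n) c (x, y) \<longleftrightarrow> odd (x + y) \<and> zero_square c (x, y) \<and>
     (reach s n c (x + s, y + 1) \<or> reach s n c (x + s, y - 1))"

lemma reach_square: "reach s n c (x, y) \<Longrightarrow> odd (x + y) \<and> zero_square c (x, y)"
  by (cases n) auto

lemma reach_Suc: "reach s (Suc n) c q \<Longrightarrow> reach s n c q"
proof (induction n arbitrary: q)
  case 0
  then show ?case by (cases q) auto
next
  case (Suc n)
  obtain x y where q: "q = (x, y)" by (cases q)
  have "reach s (Suc m) c q \<longleftrightarrow> odd (x + y) \<and> zero_square c (x, y) \<and>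
     (reach s m c (x + s, y + 1) \<or> reach s m c (x + s, y - 1))" for m
    unfolding q by (rule reach.simps(2))
  from this[of "Suc n"] this[of n] show ?case
    using Suc.prems Suc.IH by blast
qed

lemma reach_antimono:
  assumes "m \<le> n" "reach s n c q" shows "reach s m c q"
  using assms by (induction n rule: dec_induct) (auto dest: reach_Suc)

text \<open>Koenig's lemma with two branches: if each continuation failed at some horizon, both
  would fail at the larger one, since \<open>reach\<close> only gets harder as the horizon
  grows.\<close>

lemma reach_step:
  assumes "\<forall>n. reach s n c (x, y)"
  shows "(\<forall>n. reach s n c (x + s, y + 1)) \<or> (\<forall>n. reach s n c (x + s, y - 1))"
proof (rule ccontr)
  assume "\<not> ?thesis"
  then obtain m n where "\<not> reach s m c (x + s, y + 1)" "\<not> reach s n c (x + s, y - 1)"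
    by blast
  then have "\<not> reach s (max m n) c (x + s, y + 1)" "\<not> reach s (max m n) c (x + s, y - 1)"
    using reach_antimono[of m "max m n"] reach_antimono[of n "max m n"] by auto
  with assms[rule_format, of "Suc (max m n)"] show False by simp
qed

text \<open>The half path is chosen step by step under the invariant that every finite horizon
  remains reachable. Its height in column 0 is fixed so that two halves can be glued.\<close>

lemma reach_forever:
  assumes "\<forall>n. reach s n c (0, k)"
  shows "\<exists>f. f 0 = k \<and> (\<forall>n. \<bar>f (Suc n) - f n\<bar> = 1 \<and> odd (s * int n + f n) \<and>
    zero_square c (s * int n, f n))"
proof -
  have "\<exists>f. \<forall>n. ((\<forall>m. reach s m c (s * int n, f n)) \<and> (n = 0 \<longrightarrow> f n = k)) \<and> \<bar>f (Suc n) - f n\<bar> = 1"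
  proof (rule dependent_nat_choice)
    show "\<exists>y. (\<forall>m. reach s m c (s * int 0, y)) \<and> (0 = (0::nat) \<longrightarrow> y = k)"
      using assms by auto
  next
    fix y n assume "(\<forall>m. reach s m c (s * int n, y)) \<and> (n = 0 \<longrightarrow> y = k)"
    then have "(\<forall>m. reach s m c (s * int (Suc n), y + 1)) \<or> (\<forall>m. reach s m c (s * int (Suc n), y - 1))"
      using reach_step[of s c "s * int n" y] by (simp add: distrib_left add.commute)
    then show "\<exists>y'. ((\<forall>m. reach s m c (s * int (Suc n), y')) \<and> (Suc n = 0 \<longrightarrow> y' = k)) \<and> \<bar>y' - y\<bar> = 1"
    proof
      assume "\<forall>m. reach s m c (s * int (Suc n), y + 1)"
      then show ?thesis by (intro exI[of _ "y + 1"]) auto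
    next
      assume "\<forall>m. reach s m c (s * int (Suc n), y - 1)"
      then show ?thesis by (intro exI[of _ "y - 1"]) auto
    qed
  qed
  then obtain f where f: "\<And>n. ((\<forall>m. reach s m c (s * int n, f n)) \<and> (n = 0 \<longrightarrow> f n = k)) \<and> \<bar>f (Suc n) - f n\<bar> = 1"
    by blast
  have "odd (s * int n + f n) \<and> zero_square c (s * int n, f n)" for n
    using f[of n] by (intro reach_square[of s 0]) blast
  with f show ?thesis by blast
qed

lemma zero_pathD:
  assumes "zero_path c y"
  shows "odd (i + y i)" "zero_square c (i, y i)" "s = 1 \<or> s = -1 \<Longrightarrow> \<bar>y (i + s) - y i\<bar> = 1"
proof -
  show "odd (i + y i)" "zero_square c (i, y i)" using assms unfolding zero_path_def by blast+
  have *: "\<bar>y (j + 1) - y j\<bar> = 1" for j using assms unfolding zero_path_def by blast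
  show "\<bar>y (i + s) - y i\<bar> = 1" if "s = 1 \<or> s = -1"
    using that *[of i] *[of "i - 1"] by (auto simp: abs_minus_commute)
qed

lemma zero_path_reach:
  assumes y: "zero_path c y" and s: "s = 1 \<or> s = -1"
  shows "reach s n c (i, y i)"
proof (induction n arbitrary: i)
  case 0
  then show ?case using zero_pathD(1,2)[OF y, of i] by simp
next
  case (Suc n)
  have "y (i + s) = y i + 1 \<or> y (i + s) = y i - 1"
    using zero_pathD(3)[OF y s, of i] by arith
  then show ?case using Suc[of "i + s"] zero_pathD(1,2)[OF y, of i] by auto
qed

text \<open>Trades the quantifier over functions for quantifiers over integers and naturals, which
  makes the event visibly measurable.\<close>

lemma ex_zero_path_iff:
  "(\<exists>y. zero_path c y) \<longleftrightarrow> (\<exists>k. \<forall>n. reach 1 n c (0, k) \<and> reach (-1) n c (0, k))"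
proof
  assume "\<exists>y. zero_path c y"
  then show "\<exists>k. \<forall>n. reach 1 n c (0, k) \<and> reach (-1) n c (0, k)"
    using zero_path_reach by blast
next
  assume "\<exists>k. \<forall>n. reach 1 n c (0, k) \<and> reach (-1) n c (0, k)"
  then obtain k where k: "\<forall>n. reach 1 n c (0, k)" "\<forall>n. reach (-1) n c (0, k)" by blast
  obtain f where f: "f 0 = k" "\<And>n. \<bar>f (Suc n) - f n\<bar> = 1 \<and> odd (1 * int n + f n) \<and>
      zero_square c (1 * int n, f n)"
    using reach_forever[OF k(1)] by blast
  obtain g where g: "g 0 = k" "\<And>n. \<bar>g (Suc n) - g n\<bar> = 1 \<and> odd (-1 * int n + g n) \<and>
      zero_square c (-1 * int n, g n)"
    using reach_forever[OF k(2)] by blast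
  \<comment> \<open>The right half \<open>f\<close> and the left half \<open>g\<close> are glued in
    column 0, where both have height \<open>k\<close>.\<close>
  define y where "y i = (if i \<ge> 0 then f (nat i) else g (nat (- i)))" for i
  have "odd (i + y i) \<and> \<bar>y (i + 1) - y i\<bar> = 1 \<and> zero_square c (i, y i)" for i
  proof (cases "i \<ge> 0")
    case True
    then have "nat (i + 1) = Suc (nat i)" by simp
    then show ?thesis
      using True f(2)[of "nat i"] by (simp add: y_def)
  next
    case False
    define n where "n = nat (- i - 1)"
    have n: "i = - int (Suc n)" using False by (simp add: n_def)
    \<comment> \<open>For \<open>n = 0\<close> the column \<open>i + 1\<close> is 0, where
      \<open>y\<close> is read off from \<open>f\<close>; here \<open>f 0 = g 0\<close> is
      used.\<close>
    have y1: "y (i + 1) = g n" by (cases n) (auto simp: y_def n f(1) g(1) nat_add_distrib)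
    have y0: "y i = g (Suc n)" by (simp add: y_def n nat_add_distrib del: of_nat_Suc)
    show ?thesis
      using g(2)[of n] g(2)[of "Suc n"] unfolding y1 y0 unfolding n by (simp add: abs_minus_commute)
  qed
  then show "\<exists>y. zero_path c y" unfolding zero_path_def by (intro exI[of _ y] allI)
qed

section \<open>Lattice edges, monotonicity in the costs, diagonal rays\<close>

lemma edge_in_edges:
  assumes "even (x + y)" "\<bar>h\<bar> = 1" "\<bar>v\<bar> = 1"
  shows "{(x, y), (x + h, y + v)} \<in> edges"
proof -
  have "dist (embed (x, y)) (embed (x + h, y + v)) = sqrt ((of_int h)\<^sup>2 + (of_int v)\<^sup>2)"
    by (simp add: embed_def dist_prod_def dist_real_def power2_commute)
  also have "\<dots> = sqrt 2"
    using assms(2,3) by (auto simp: abs_if split: if_splits)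
  finally have d: "dist (embed (x, y)) (embed (x + h, y + v)) = sqrt 2" .
  have "even (x + h + (y + v))" using assms by (auto simp: abs_if split: if_splits)
  then show ?thesis
    using d assms(1) unfolding edges_def lattice_def mem_Collect_eq
    by (intro exI[of _ "(x, y)"] exI[of _ "(x + h, y + v)"]) simp
qed

lemma square_edges_subset:
  assumes "odd (x + y)" shows "square_edges (x, y) \<subseteq> edges"
proof -
  have *: "even (x + 1 + y)" "even (x + (y + 1))" "even (x - 1 + y)" "even (x + (y - 1))"
    using assms by auto
  show ?thesis
    using edge_in_edges[OF *(1), of "-1" 1] edge_in_edges[OF *(2), of "-1" "-1"]
      edge_in_edges[OF *(3), of 1 "-1"] edge_in_edges[OF *(4), of 1 1]
    by (simp add: square_edges_def)
qed

lemma zero_path_mono: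
  assumes y: "zero_path c y" and c': "\<And>e. e \<in> edges \<Longrightarrow> c e = 0 \<Longrightarrow> c' e = 0"
  shows "zero_path c' y"
  unfolding zero_path_def
proof
  fix i
  have "zero_square c' (i, y i)"
    using zero_pathD(2)[OF y, of i] square_edges_subset[OF zero_pathD(1)[OF y, of i]] c'
    unfolding zero_square_def by blast
  then show "odd (i + y i) \<and> \<bar>y (i + 1) - y i\<bar> = 1 \<and> zero_square c' (i, y i)"
    using y unfolding zero_path_def by blast
qed

definition ray_edge :: "point \<Rightarrow> int \<times> int \<Rightarrow> nat \<Rightarrow> edge" where
  "ray_edge q d k = {(fst q + int k * fst d, snd q + int k * snd d),
     (fst q + int (Suc k) * fst d, snd q + int (Suc k) * snd d)}"

lemma ray_edge_in_edges:
  assumes "q \<in> lattice" "\<bar>fst d\<bar> = 1" "\<bar>snd d\<bar> = 1"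
  shows "ray_edge q d k \<in> edges"
proof -
  have "even (fst q + int k * fst d + (snd q + int k * snd d))"
    using assms by (auto simp: lattice_def abs_if split: if_splits)
  moreover have "a + int (Suc k) * b = a + int k * b + b" for a b
    by (simp add: distrib_right)
  ultimately show ?thesis
    using edge_in_edges assms(2,3) unfolding ray_edge_def by presburger
qed

text \<open>The abscissae of an edge already determine its index: matching the two ends crosswise
  would require both \<open>k = l + 1\<close> and \<open>k + 1 = l\<close>. Distinct edges have
  independent costs, which is what \<open>AE_ray\<close> exploits.\<close>

lemma inj_ray_edge:
  assumes "\<bar>fst d\<bar> = 1"
  shows "inj (ray_edge q d)"
proof (rule injI)
  fix k l assume "ray_edge q d k = ray_edge q d l"
  then have "fst ` ray_edge q d k = fst ` ray_edge q d l" by (rule arg_cong)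
  then have "int k * fst d = int l * fst d \<or>
      int k * fst d = int (Suc l) * fst d \<and> int (Suc k) * fst d = int l * fst d"
    unfolding ray_edge_def image_insert image_empty fst_conv doubleton_eq_iff by linarith
  moreover have "fst d \<noteq> 0" using assms by auto
  ultimately show "k = l" by auto
qed

section \<open>Playing towards a zero path\<close>

text \<open>Histories record non-oriented edges, not positions. Folding this function over a
  history, starting from the initial point, recovers the position of the token.\<close>

definition other_end :: "point \<Rightarrow> edge \<Rightarrow> point" where
  "other_end q e = the_elem (e - {q})"

text \<open>The token never lies at height \<open>Y\<close> of its column: points of the lattice
  have even coordinate sum, centers of squares odd. So \<open>Bottom\<close> is played exactly when
  the token is above the path.\<close>

definition path_strategy :: "(int \<Rightarrow> int) \<Rightarrow> point \<Rightarrow> strategy1" where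
  "path_strategy Y z h =
     (let q = foldl other_end z h in if snd q < Y (fst q) then Top else Bottom)"

lemma other_end_doubleton: "q \<noteq> q' \<Longrightarrow> other_end q {q, q'} = q'"
proof -
  assume "q \<noteq> q'"
  then have "{q, q'} - {q} = {q'}" by auto
  then show ?thesis by (simp add: other_end_def)
qed

text \<open>Player 2 controls only the sign \<open>h\<close>. Later arguments keep \<open>h\<close>
  arbitrary and thus hold against every strategy of Player 2.\<close>

lemma move_cases:
  "\<exists>h. \<bar>h\<bar> = 1 \<and> move q a b = (fst q + h, snd q + (if a = Top then 1 else -1))"
proof (cases q)
  case (Pair x y)
  show ?thesis unfolding Pair
    by (cases a; cases b) (auto intro: exI[of _ 1] exI[of _ "-1"])
qed

lemma play_Suc_fst:
  "fst (play z \<sigma> \<tau> (Suc n)) = move (fst (play z \<sigma> \<tau> n)) (\<sigma> (snd (play z \<sigma> \<tau> n)))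
     (reply (\<tau> (snd (play z \<sigma> \<tau> n))) (\<sigma> (snd (play z \<sigma> \<tau> n))))"
  by (simp add: Let_def split: prod.split)

lemma foldl_other_end_play: "foldl other_end z (snd (play z \<sigma> \<tau> n)) = fst (play z \<sigma> \<tau> n)"
proof (induction n)
  case 0
  then show ?case by simp
next
  case (Suc n)
  define q h where "q = fst (play z \<sigma> \<tau> n)" and "h = snd (play z \<sigma> \<tau> n)"
  then have qh: "play z \<sigma> \<tau> n = (q, h)" by simp
  define q' where "q' = move q (\<sigma> h) (reply (\<tau> h) (\<sigma> h))"
  have "q \<noteq> q'" using move_cases[of q "\<sigma> h" "reply (\<tau> h) (\<sigma> h)"]
    unfolding q'_def[symmetric] by (cases q) auto
  moreover have "play z \<sigma> \<tau> (Suc n) = (q', h @ [{q, q'}])"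
    by (simp add: qh q'_def Let_def)
  ultimately show ?case using Suc by (simp add: qh other_end_doubleton)
qed

lemma play_path_strategy_step:
  fixes Y z \<tau>
  defines "q \<equiv> \<lambda>n. fst (play z (path_strategy Y z) \<tau> n)"
  shows "\<exists>h. \<bar>h\<bar> = 1 \<and>
    q (Suc n) = (fst (q n) + h, snd (q n) + (if snd (q n) < Y (fst (q n)) then 1 else -1))"
proof -
  let ?h = "snd (play z (path_strategy Y z) \<tau> n)"
  have "path_strategy Y z ?h = (if snd (q n) < Y (fst (q n)) then Top else Bottom)"
    by (simp add: path_strategy_def Let_def foldl_other_end_play q_def)
  then show ?thesis
    using move_cases[of "q n" "path_strategy Y z ?h" "reply (\<tau> ?h) (path_strategy Y z ?h)"]
    unfolding q_def play_Suc_fst by (simp split: if_splits)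
qed

text \<open>A token next to the center \<open>(x, y)\<close>, at height \<open>y - v\<close>,
  crosses this edge when it moves vertically towards the path.\<close>

lemma slanted_edge_in_square_edges:
  assumes "\<bar>h\<bar> = 1" "\<bar>v\<bar> = 1"
  shows "{(x, y - v), (x + h, y)} \<in> square_edges (x, y)"
proof -
  have "h = 1 \<or> h = -1" "v = 1 \<or> v = -1" using assms by arith+
  then show ?thesis by (elim disjE) (simp_all add: square_edges_def doubleton_eq_iff)
qed

lemma even_play:
  assumes "z \<in> lattice"
  shows "even (fst (fst (play z \<sigma> \<tau> n)) + snd (fst (play z \<sigma> \<tau> n)))"
proof (induction n)
  case 0
  then show ?case using assms by (auto simp: lattice_def)
next
  case (Suc n)
  define q where "q = fst (play z \<sigma> \<tau> n)"
  obtain h a where "\<bar>h\<bar> = 1" "fst (play z \<sigma> \<tau> (Suc n)) = (fst q + h, snd q + (if a = Top then 1 else -1))"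
    unfolding play_Suc_fst q_def using move_cases by metis
  then show ?case using Suc unfolding q_def by (auto simp: abs_if split: if_splits)
qed

lemma crossed_edge_Suc:
  "crossed_edge z \<sigma> \<tau> (Suc n) = {fst (play z \<sigma> \<tau> n), fst (play z \<sigma> \<tau> (Suc n))}"
  unfolding crossed_edge_def by simp

lemma crossed_edge_in_edges:
  assumes "z \<in> lattice"
  shows "crossed_edge z \<sigma> \<tau> (Suc n) \<in> edges"
proof -
  define q where "q = fst (play z \<sigma> \<tau> n)"
  obtain h a where "\<bar>h\<bar> = 1" "fst (play z \<sigma> \<tau> (Suc n)) = (fst q + h, snd q + (if a = Top then 1 else -1))"
    unfolding play_Suc_fst q_def using move_cases by metis
  moreover have "even (fst q + snd q)" unfolding q_def by (rule even_play[OF assms])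
  ultimately show ?thesis
    using edge_in_edges[of "fst q" "snd q" h "if a = Top then 1 else -1"]
    unfolding crossed_edge_Suc by (simp add: q_def)
qed

lemma path_strategy_eventually_zero:
  assumes Y: "zero_path c Y" and z: "z \<in> lattice"
    and no_ray: "\<And>q d. q \<in> lattice \<Longrightarrow> \<bar>fst d\<bar> = 1 \<Longrightarrow> \<bar>snd d\<bar> = 1 \<Longrightarrow> \<exists>k. c (ray_edge q d k) \<noteq> 0"
  shows "\<exists>N. \<forall>m>N. c (crossed_edge z (path_strategy Y z) \<tau> m) = 0"
proof -
  define q where "q n = fst (play z (path_strategy Y z) \<tau> n)" for n
  define X where "X n = fst (q n)" for n
  define y where "y n = snd (q n)" for n
  define v :: "nat \<Rightarrow> int" where "v n = (if y n < Y (X n) then 1 else -1)" for n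
  define h where "h n = X (Suc n) - X n" for n
  define D where "D n = \<bar>Y (X n) - y n\<bar>" for n
  have h1: "\<bar>h n\<bar> = 1" and y_Suc: "y (Suc n) = y n + v n" for n
    using play_path_strategy_step[where n=n and z=z and Y=Y and \<tau>=\<tau>]
    unfolding h_def X_def y_def v_def q_def by auto
  have X_Suc: "X (Suc n) = X n + h n" for n by (simp add: h_def)
  have v1: "\<bar>v n\<bar> = 1" for n by (simp add: v_def)
  have Y_step: "\<bar>Y (X (Suc n)) - Y (X n)\<bar> = 1" for n
  proof -
    have "h n = 1 \<or> h n = -1" using h1[of n] by arith
    from zero_pathD(3)[OF Y this] show ?thesis unfolding X_Suc .
  qed
  have D_nonneg: "0 \<le> D n" for n by (simp add: D_def)
  \<comment> \<open>In one column, the coordinate sums of the token and of the center on the path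
    have opposite parities.\<close>
  have odd_D: "odd (D n)" for n
    using even_play[OF z, of "path_strategy Y z" \<tau> n] zero_pathD(1)[OF Y, of "X n"]
    unfolding D_def X_def y_def q_def by (simp add: even_add)
  \<comment> \<open>The token comes closer by 1 and the path moves by 1 up or down, so the distance
    measured in direction \<open>v n\<close> becomes \<open>D n\<close> or \<open>D n - 2\<close>.
    As \<open>D n\<close> is at least 1, the absolute value does not grow.\<close>
  have D_Suc: "D (Suc n) \<le> D n" for n
  proof -
    have "Y (X n) \<noteq> y n" using odd_D[of n] by (auto simp: D_def)
    then show ?thesis
      using Y_step[of n] y_Suc[of n] unfolding D_def v_def by (cases "y n < Y (X n)") auto
  qed
  \<comment> \<open>A time \<open>N\<close> at which the distance is minimal; by monotonicity it is
    constant from then on.\<close>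
  have "\<exists>N. \<forall>n. D N \<le> D n"
    using ex_has_least_nat[of "\<lambda>_. True" 0 "\<lambda>n. nat (D n)", OF TrueI]
    by (simp only: simp_thms nat_le_eq_zle[OF disjI2] D_nonneg)
  then obtain N where min: "\<And>n. D N \<le> D n" by (elim exE) (use that in blast)
  have "antimono D" by (rule decseq_SucI) (rule D_Suc)
  then have const: "D n = D N" if "n \<ge> N" for n
    using min[of n] that by (auto dest: antimonoD[of D N n])
  \<comment> \<open>This edge of the path square in column \<open>X n\<close> starts at the corner
    facing the token. If \<open>D n = 1\<close> it is the edge being crossed; otherwise it is a
    parallel translate of that edge, and these translates will form the ray.\<close>
  have zero: "c {(X n, Y (X n) - v n), (X n + h n, Y (X n))} = 0" for n
    using zero_pathD(2)[OF Y, of "X n"] slanted_edge_in_square_edges[OF h1[of n] v1[of n]]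
    unfolding zero_square_def by blast
  show ?thesis
  proof (cases "D N = 1")
    case True
    have "c (crossed_edge z (path_strategy Y z) \<tau> m) = 0" if m: "m > N" for m
    proof -
      obtain n where n: "m = Suc n" "n \<ge> N" using m by (cases m) auto
      have "D n = 1" using const[OF n(2)] True by simp
      then have y: "y n = Y (X n) - v n" by (auto simp: D_def v_def)
      have "crossed_edge z (path_strategy Y z) \<tau> m = {(X n, y n), (X (Suc n), y (Suc n))}"
        by (simp add: n(1) crossed_edge_Suc X_def y_def q_def del: play.simps)
      also have "\<dots> = {(X n, Y (X n) - v n), (X n + h n, Y (X n))}"
        by (simp add: X_Suc y_Suc y)
      finally show ?thesis using zero by simp
    qed
    then show ?thesis by blast
  next
    case False
    then have D3: "D N \<ge> 3" using odd_D[of N] by (simp add: D_def) presburger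
    \<comment> \<open>A constant distance forces the path to recede as fast as the token advances; a
      distance of at least 3 prevents the token from changing sides.\<close>
    have stay: "v (Suc n) = v n" "Y (X (Suc n)) = Y (X n) + v n" if "n \<ge> N" for n
    proof -
      have "D n \<ge> 3" "D (Suc n) = D n" using const[of n] const[of "Suc n"] that D3 by auto
      then show "v (Suc n) = v n" "Y (X (Suc n)) = Y (X n) + v n"
        using Y_step[of n] y_Suc[of n] unfolding D_def v_def by (auto split: if_splits)
    qed
    \<comment> \<open>Reversing direction would bring the token back to column \<open>X n\<close>
      after the path height had changed by \<open>2 * v n\<close>, although that height depends on
      the column only.\<close>
    have turn: "h (Suc n) = h n" if "n \<ge> N" for n
    proof (rule ccontr)
      assume "h (Suc n) \<noteq> h n"
      then have "h (Suc n) = - h n" using h1[of n] h1[of "Suc n"] by arith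
      then have "X (Suc (Suc n)) = X n" by (simp add: X_Suc)
      then show False using stay[of n] stay[of "Suc n"] that v1[of n] by simp
    qed
    have along: "v (N + k) = v N \<and> h (N + k) = h N \<and>
        X (N + k) = X N + int k * h N \<and> Y (X (N + k)) = Y (X N) + int k * v N" for k
    proof (induction k)
      case 0
      then show ?case by simp
    next
      case (Suc k)
      have "N \<le> N + k" by simp
      show ?case
        unfolding add_Suc_right of_nat_Suc distrib_right mult_1
          stay[OF \<open>N \<le> N + k\<close>] turn[OF \<open>N \<le> N + k\<close>]
        unfolding X_Suc using Suc
        by (intro conjI) linarith+
    qed
    let ?q = "(X N, Y (X N) - v N)"
    \<comment> \<open>With \<open>h\<close> and \<open>v\<close> constant, each facing edge ends
      where the next begins, so together they are the ray from \<open>?q\<close>.\<close>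
    have "c (ray_edge ?q (h N, v N) k) = 0" for k
    proof -
      from along[of k] have "v (N + k) = v N" "h (N + k) = h N" "X (N + k) = X N + int k * h N"
        "Y (X (N + k)) = Y (X N) + int k * v N" by blast+
      with zero[of "N + k"]
      have "c {(X N + int k * h N, Y (X N) + int k * v N - v N),
          (X N + int k * h N + h N, Y (X N) + int k * v N)} = 0" by metis
      then show ?thesis by (simp add: ray_edge_def distrib_right algebra_simps)
    qed
    moreover have "?q \<in> lattice"
      using zero_pathD(1)[OF Y, of "X N"] v1[of N] unfolding lattice_def by simp presburger
    ultimately show ?thesis using no_ray[of ?q "(h N, v N)"] h1 v1 by auto
  qed
qed

section \<open>From vanishing costs to the value of the game\<close>

lemma total_cost_eventually_zero:
  assumes "\<And>m. m > N \<Longrightarrow> c (crossed_edge z \<sigma> \<tau> m) = 0"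
  shows "total_cost c z \<sigma> \<tau> = 0"
proof -
  define C where "C = (\<Sum>m = 1..N. c (crossed_edge z \<sigma> \<tau> m))"
  have "(\<Sum>m = 1..n. c (crossed_edge z \<sigma> \<tau> m)) = C" if "n \<ge> N" for n
    unfolding C_def using that assms by (intro sum.mono_neutral_right) auto
  then have "\<forall>\<^sub>F n in sequentially. C / real n = (1 / real n) * (\<Sum>m = 1..n. c (crossed_edge z \<sigma> \<tau> m))"
    by (intro eventually_sequentiallyI[of N]) simp
  moreover have "(\<lambda>n. C / real n) \<longlonglongrightarrow> 0" by (rule lim_const_over_n)
  ultimately have "(\<lambda>n. (1 / real n) * (\<Sum>m = 1..n. c (crossed_edge z \<sigma> \<tau> m))) \<longlonglongrightarrow> 0"
    by (blast intro: Lim_transform_eventually)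
  then have "(\<lambda>n. ereal ((1 / real n) * (\<Sum>m = 1..n. c (crossed_edge z \<sigma> \<tau> m)))) \<longlonglongrightarrow> ereal 0"
    by (rule tendsto_ereal)
  from lim_imp_Limsup[OF _ this] show ?thesis by (simp add: total_cost_def zero_ereal_def)
qed

lemma total_cost_nonneg:
  assumes "\<And>e. e \<in> edges \<Longrightarrow> c e \<ge> 0" "z \<in> lattice"
  shows "total_cost c z \<sigma> \<tau> \<ge> 0"
  unfolding total_cost_def
proof (rule le_Limsup)
  have "c (crossed_edge z \<sigma> \<tau> m) \<ge> 0" if "m \<ge> 1" for m
    using assms crossed_edge_in_edges[OF assms(2), of \<sigma> \<tau> "m - 1"] that by simp
  then have "ereal (1 / real n * (\<Sum>m = 1..n. c (crossed_edge z \<sigma> \<tau> m))) \<ge> 0" for n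
    by (auto intro!: mult_nonneg_nonneg sum_nonneg divide_nonneg_nonneg)
  then show "\<forall>\<^sub>F n in sequentially. 0 \<le> ereal (1 / real n * (\<Sum>m = 1..n. c (crossed_edge z \<sigma> \<tau> m)))"
    by simp
qed simp

text \<open>Weak duality squeezes both values: \<open>\<sigma>\<close> guarantees 0 from above,
  nonnegative costs guarantee 0 from below.\<close>

lemma has_value_0:
  assumes nonneg: "\<And>e. e \<in> edges \<Longrightarrow> c e \<ge> 0" and z: "z \<in> lattice"
    and \<sigma>: "\<And>\<tau>. \<exists>N. \<forall>m>N. c (crossed_edge z \<sigma> \<tau> m) = 0"
  shows "has_value c z 0"
proof -
  have "total_cost c z \<sigma> \<tau> = 0" for \<tau>
    using \<sigma>[of \<tau>] total_cost_eventually_zero by blast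
  then have "(INF \<sigma>. SUP \<tau>. total_cost c z \<sigma> \<tau>) \<le> 0"
    by (intro INF_lower2[of \<sigma>]) auto
  moreover have "(SUP \<tau>. INF \<sigma>. total_cost c z \<sigma> \<tau>) \<le> (INF \<sigma>. SUP \<tau>. total_cost c z \<sigma> \<tau>)"
    by (intro SUP_least INF_greatest) (blast intro: order_trans INF_lower SUP_upper)
  \<comment> \<open>Any strategy of Player 2 serves as a witness for this bound;
    \<open>undefined\<close> names one.\<close>
  moreover have "0 \<le> (SUP \<tau>. INF \<sigma>. total_cost c z \<sigma> \<tau>)"
    by (intro SUP_upper2[of undefined] INF_greatest total_cost_nonneg nonneg z) auto
  ultimately show ?thesis
    unfolding has_value_def zero_ereal_def[symmetric] by (intro conjI) order+
qed

lemma has_value_unique: "has_value c z v \<Longrightarrow> has_value c z w \<Longrightarrow> v = w"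
  by (simp add: has_value_def)

section \<open>Coupling and shift invariance of the cost law\<close>

abbreviation coin :: "real \<Rightarrow> real pmf" where
  "coin p \<equiv> map_pmf of_bool (bernoulli_pmf p)"

text \<open>The product sigma-algebra on the coordinates in \<open>J\<close>, free of the parameter
  \<open>p\<close>. For \<open>J = edges\<close> it is that of every \<open>cost_law p\<close>;
  smaller \<open>J\<close> express that an event depends on part of the costs.\<close>

abbreviation cost_space :: "edge set \<Rightarrow> (edge \<Rightarrow> real) measure" where
  "cost_space J \<equiv> PiM J (\<lambda>_. count_space UNIV)"

lemma prob_space_PiM_pmf: "prob_space (PiM I (\<lambda>i. measure_pmf (q i)))"
  by (intro prob_space_PiM prob_space_measure_pmf)

lemma prob_space_cost_law: "prob_space (cost_law p)"
  unfolding cost_law_def by (rule prob_space_PiM_pmf)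

lemma sets_cost_law [measurable_cong]: "sets (cost_law p) = sets (cost_space edges)"
  unfolding cost_law_def by (intro sets_PiM_cong) simp_all

lemma space_cost_law: "space (cost_law p) = extensional edges"
  by (simp add: cost_law_def space_PiM PiE_UNIV_domain PiE_def)

lemma countable_edges: "countable edges"
proof -
  have "edges \<subseteq> range (\<lambda>(a, b). {a, b})" unfolding edges_def by auto
  then show ?thesis by (rule countable_subset) simp
qed

text \<open>On the product space, restriction to \<open>I\<close> is the identity, so the joint law
  of the coordinates is the product of their marginals.\<close>

lemma indep_vars_PiM_coordinates:
  assumes M: "\<And>i. i \<in> I \<Longrightarrow> prob_space (M i)" and "I \<noteq> {}"
  shows "prob_space.indep_vars (PiM I M) M (\<lambda>i \<omega>. \<omega> i) I"
proof -
  interpret prob_space "PiM I M" using M by (rule prob_space_PiM)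
  have "distr (PiM I M) (PiM I M) (\<lambda>\<omega>. \<lambda>i\<in>I. \<omega> i) = distr (PiM I M) (PiM I M) (\<lambda>\<omega>. \<omega>)"
    by (intro distr_cong) (auto simp: space_PiM PiE_def extensional_restrict)
  also have "\<dots> = PiM I M" by (rule distr_id)
  also have "\<dots> = PiM I (\<lambda>i. distr (PiM I M) (M i) (\<lambda>\<omega>. \<omega> i))"
    using M by (intro PiM_cong refl distr_PiM_component[symmetric]) auto
  finally show ?thesis
    by (subst indep_vars_iff_distr_eq_PiM'[OF \<open>I \<noteq> {}\<close>]) simp_all
qed

lemma measurable_component_pmf:
  "i \<in> I \<Longrightarrow> (\<lambda>\<omega>. f (\<omega> i)) \<in> measurable (PiM I (\<lambda>_. measure_pmf q)) (measure_pmf q')"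
  by (rule measurable_compose[OF measurable_component_singleton]) simp_all

text \<open>Independent coordinates stay independent after applying \<open>f\<close> to each, so the
  image law is again a product and only the marginals must be computed.\<close>

lemma distr_PiM_map_pmf:
  assumes "I \<noteq> {}"
  shows "distr (PiM I (\<lambda>_. measure_pmf q)) (PiM I (\<lambda>_. measure_pmf (map_pmf f q))) (\<lambda>\<omega>. \<lambda>i\<in>I. f (\<omega> i)) =
    PiM I (\<lambda>_. measure_pmf (map_pmf f q))"
proof -
  let ?P = "PiM I (\<lambda>_. measure_pmf q)" and ?q = "measure_pmf (map_pmf f q)"
  interpret prob_space ?P by (rule prob_space_PiM_pmf)
  have "indep_vars (\<lambda>_. measure_pmf q) (\<lambda>i \<omega>. \<omega> i) I"
    using assms by (intro indep_vars_PiM_coordinates prob_space_measure_pmf)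
  then have "indep_vars (\<lambda>_. ?q) (\<lambda>i \<omega>. f (\<omega> i)) I"
    by (rule indep_vars_compose2) simp
  then have "distr ?P (PiM I (\<lambda>_. ?q)) (\<lambda>\<omega>. \<lambda>i\<in>I. f (\<omega> i)) =
      PiM I (\<lambda>i. distr ?P ?q (\<lambda>\<omega>. f (\<omega> i)))"
    using indep_vars_iff_distr_eq_PiM'[where X = "\<lambda>i \<omega>. f (\<omega> i)" and M' = "\<lambda>_. ?q", OF assms measurable_component_pmf] by blast
  also have "\<dots> = PiM I (\<lambda>_. ?q)"
  proof (intro PiM_cong refl)
    fix i assume i: "i \<in> I"
    have "distr ?P ?q (\<lambda>\<omega>. f (\<omega> i)) = distr (distr ?P (measure_pmf q) (\<lambda>\<omega>. \<omega> i)) ?q f"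
      using i by (subst distr_distr) (simp_all add: comp_def)
    also have "\<dots> = distr (measure_pmf q) ?q f"
      using i by (subst distr_PiM_component) (auto intro: prob_space_measure_pmf)
    also have "\<dots> = ?q"
      unfolding map_pmf_rep_eq by (intro distr_cong) simp_all
    finally show "distr ?P ?q (\<lambda>\<omega>. f (\<omega> i)) = ?q" .
  qed
  finally show ?thesis .
qed

lemma edges_nonempty: "edges \<noteq> {}"
  using edge_in_edges[of 0 0 1 1] by auto

lemma bernoulli_pmf_mult:
  assumes "p \<in> {0..1}" "r \<in> {0..1}"
  shows "map_pmf (\<lambda>(a, b). a \<and> b) (pair_pmf (bernoulli_pmf p) (bernoulli_pmf r)) = bernoulli_pmf (p * r)"
proof -
  have *: "pmf (map_pmf (\<lambda>(a, b). a \<and> b) (pair_pmf (bernoulli_pmf p) (bernoulli_pmf r))) True = p * r"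
  proof -
    have "(\<lambda>(a, b). a \<and> b) -` {True} = {(True, True)}" by auto
    then show ?thesis using assms by (simp add: pmf_map measure_pmf_single pmf_pair)
  qed
  have "p * r \<in> {0..1}" using assms by (auto intro: mult_le_one)
  then show ?thesis
    using * by (intro pmf_eqI) (metis (full_types) atLeastAtMost_iff pmf_False_conv_True pmf_bernoulli_True)
qed

text \<open>Thinning: multiplying costs by independent Bernoulli variables lowers the parameter.\<close>
lemma measure_cost_law_antimono:
  assumes "0 \<le> p" "p \<le> p'" "p' \<le> 1"
    and A: "{c \<in> space (cost_space edges). P c} \<in> sets (cost_space edges)"
    and P: "\<And>c c'. P c \<Longrightarrow> (\<And>e. e \<in> edges \<Longrightarrow> c e = 0 \<Longrightarrow> c' e = 0) \<Longrightarrow> P c'"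
  shows "measure (cost_law p') {c \<in> space (cost_law p'). P c}
    \<le> measure (cost_law p) {c \<in> space (cost_law p). P c}"
proof (cases "p' = 0")
  case True
  then show ?thesis using assms by simp
next
  case False
  \<comment> \<open>The retention probability of the thinning; \<open>p'\<close> is positive in this
    case.\<close>
  define r where "r = p / p'"
  have r: "r \<in> {0..1}" and pr: "p = p' * r" using assms False by (auto simp: r_def field_simps)
  let ?q = "pair_pmf (bernoulli_pmf p') (bernoulli_pmf r)"
  define Q where "Q = PiM edges (\<lambda>_. measure_pmf ?q)"
  interpret Q: prob_space Q unfolding Q_def by (rule prob_space_PiM_pmf)
  \<comment> \<open>Both cost laws are images of the single product measure \<open>Q\<close>:
    reading the first bit gives \<open>p'\<close>, the conjunction of the two bits gives
    \<open>p\<close>.\<close>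
  have law: "measure (cost_law x) {c \<in> space (cost_law x). P c} =
      measure Q {\<omega> \<in> space Q. P (\<lambda>e\<in>edges. f (\<omega> e))}"
    and meas: "{\<omega> \<in> space Q. P (\<lambda>e\<in>edges. f (\<omega> e))} \<in> sets Q"
    if "map_pmf f ?q = coin x" for f x
  proof -
    have [measurable]: "(\<lambda>\<omega>. \<lambda>e\<in>edges. f (\<omega> e)) \<in> measurable Q (cost_law x)"
      unfolding Q_def cost_law_def by (intro measurable_restrict measurable_component_pmf)
    have S: "{c \<in> space (cost_law x). P c} \<in> sets (cost_law x)"
      using A unfolding sets_cost_law by (simp add: space_cost_law space_PiM PiE_def)
    have eq: "(\<lambda>\<omega>. \<lambda>e\<in>edges. f (\<omega> e)) -` {c \<in> space (cost_law x). P c} \<inter> space Q =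
        {\<omega> \<in> space Q. P (\<lambda>e\<in>edges. f (\<omega> e))}"
      by (auto simp: space_cost_law)
    have "cost_law x = distr Q (cost_law x) (\<lambda>\<omega>. \<lambda>e\<in>edges. f (\<omega> e))"
      using distr_PiM_map_pmf[OF edges_nonempty, of ?q f] unfolding Q_def cost_law_def that by simp
    then have "measure (cost_law x) {c \<in> space (cost_law x). P c} =
        measure (distr Q (cost_law x) (\<lambda>\<omega>. \<lambda>e\<in>edges. f (\<omega> e))) {c \<in> space (cost_law x). P c}"
      by simp
    also have "\<dots> = measure Q {\<omega> \<in> space Q. P (\<lambda>e\<in>edges. f (\<omega> e))}"
      using measure_distr[OF _ S, of "\<lambda>\<omega>. \<lambda>e\<in>edges. f (\<omega> e)" Q] eq by simp
    finally show "measure (cost_law x) {c \<in> space (cost_law x). P c} =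
      measure Q {\<omega> \<in> space Q. P (\<lambda>e\<in>edges. f (\<omega> e))}" .
    show "{\<omega> \<in> space Q. P (\<lambda>e\<in>edges. f (\<omega> e))} \<in> sets Q"
      using measurable_sets[OF _ S, of "\<lambda>\<omega>. \<lambda>e\<in>edges. f (\<omega> e)" Q] eq by simp
  qed
  have f1: "map_pmf (\<lambda>x. of_bool (fst x)) ?q = coin p'"
    by (simp add: pmf.map_comp[symmetric, unfolded comp_def, of of_bool fst] map_fst_pair_pmf)
  have "map_pmf (\<lambda>x. of_bool (case x of (a, b) \<Rightarrow> a \<and> b)) ?q =
      map_pmf of_bool (map_pmf (\<lambda>(a, b). a \<and> b) ?q)"
    unfolding pmf.map_comp comp_def ..
  also have "\<dots> = coin p"
    using assms r by (subst bernoulli_pmf_mult) (auto simp: pr)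
  finally have f2: "map_pmf (\<lambda>x. of_bool (case x of (a, b) \<Rightarrow> a \<and> b)) ?q = coin p" .
  show ?thesis
    unfolding law[OF f1] law[OF f2]
  \<comment> \<open>Wherever the first bit gives cost 0 so does the conjunction, hence one event
    contains the other pointwise.\<close>
  proof (rule Q.finite_measure_mono[OF _ meas[OF f2]], clarify)
    fix \<omega> :: "edge \<Rightarrow> bool \<times> bool" assume "P (\<lambda>e\<in>edges. of_bool (fst (\<omega> e)))"
    then show "P (\<lambda>e\<in>edges. of_bool (case \<omega> e of (a, b) \<Rightarrow> a \<and> b))"
      by (rule P) (auto split: prod.split if_splits)
  qed
qed

text \<open>The factor 2 keeps the shift inside the lattice.\<close>
definition shift :: "int \<Rightarrow> point \<Rightarrow> point" where
  "shift k q = (fst q, snd q + 2 * k)"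

definition shift_costs :: "int \<Rightarrow> (edge \<Rightarrow> real) \<Rightarrow> edge \<Rightarrow> real" where
  "shift_costs k c = (\<lambda>e\<in>edges. c (shift k ` e))"

lemma shift_edges: "e \<in> edges \<Longrightarrow> shift k ` e \<in> edges"
proof -
  have d: "dist (embed (shift k a)) (embed (shift k b)) = dist (embed a) (embed b)" for a b
    by (simp add: embed_def shift_def dist_prod_def dist_real_def)
  have l: "a \<in> lattice \<Longrightarrow> shift k a \<in> lattice" for a
    by (auto simp: lattice_def shift_def)
  assume "e \<in> edges"
  then obtain a b where "e = {a, b}" "a \<in> lattice" "b \<in> lattice" "dist (embed a) (embed b) = sqrt 2"
    unfolding edges_def by blast
  then show ?thesis unfolding edges_def mem_Collect_eq
    using d l by (intro exI[of _ "shift k a"] exI[of _ "shift k b"]) auto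
qed

lemma inj_shift: "inj (shift k)"
  by (auto simp: inj_def shift_def prod_eq_iff)

text \<open>Reindexing i.i.d. coordinates along an injective map of the edges preserves their joint
  law.\<close>

lemma distr_shift_costs: "distr (cost_law p) (cost_law p) (shift_costs k) = cost_law p"
  unfolding cost_law_def shift_costs_def
  by (rule distr_PiM_reindex[of edges "\<lambda>_. measure_pmf (coin p)" "(`) (shift k)" edges])
    (auto intro: prob_space_measure_pmf shift_edges simp: inj_image_eq_iff[OF inj_shift] inj_on_def)

section \<open>The zero-one law\<close>

text \<open>Bounded only vertically: strips with distant center lines are disjoint, and in this way
  events become independent of their vertical shifts.\<close>

definition strip :: "int \<Rightarrow> int \<Rightarrow> edge set" where
  "strip a H = {e \<in> edges. \<forall>q\<in>e. \<bar>snd q - a\<bar> \<le> H}"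

lemma square_edges_subset_strip:
  assumes "odd (x + y)" "\<bar>y - a\<bar> + 1 \<le> H"
  shows "square_edges (x, y) \<subseteq> strip a H"
  using square_edges_subset[OF assms(1)] assms(2) by (auto simp: strip_def square_edges_def)

text \<open>In \<open>n\<close> steps the path drifts vertically by at most \<open>n\<close>, and
  the corners of a square lie within 1 of its center.\<close>

lemma reach_cong:
  assumes "\<And>e. e \<in> strip a H \<Longrightarrow> c e = c' e" "\<bar>y - a\<bar> + int n + 1 \<le> H"
  shows "reach s n c (x, y) \<longleftrightarrow> reach s n c' (x, y)"
  using assms(2)
proof (induction n arbitrary: x y)
  have sq: "odd (x + y) \<Longrightarrow> zero_square c (x, y) \<longleftrightarrow> zero_square c' (x, y)"
    if "\<bar>y - a\<bar> + 1 \<le> H" for x y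
    using square_edges_subset_strip[OF _ that] assms(1) unfolding zero_square_def by (metis subsetD)
  {
    case 0
    then show ?case using sq[of y x] by auto
  next
    case (Suc n)
    then have "reach s n c (x + s, y + 1) \<longleftrightarrow> reach s n c' (x + s, y + 1)"
      "reach s n c (x + s, y - 1) \<longleftrightarrow> reach s n c' (x + s, y - 1)"
      by (intro Suc.IH; simp)+
    then show ?case using sq[of y x] Suc.prems by auto
  }
qed

lemma pred_zero_square:
  assumes "square_edges q \<subseteq> J"
  shows "Measurable.pred (cost_space J) (\<lambda>c. zero_square c q)"
proof -
  have *: "Measurable.pred (cost_space J) (\<lambda>c. c e = 0)" if "e \<in> J" for e
    using that by (intro measurable_compose[OF measurable_component_singleton[of e J "\<lambda>_. count_space UNIV"]]) auto
  have "finite (square_edges q)" by (cases q) (simp add: square_edges_def)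
  then show ?thesis unfolding zero_square_def using assms by (intro pred_intros_finite *) auto
qed

lemma pred_reach:
  assumes "strip a H \<subseteq> J" "\<bar>y - a\<bar> + int n + 1 \<le> H"
  shows "Measurable.pred (cost_space J) (\<lambda>c. reach s n c (x, y))"
  using assms(2)
proof (induction n arbitrary: x y)
  have sq: "Measurable.pred (cost_space J) (\<lambda>c. odd (x + y) \<and> zero_square c (x, y))"
    if "\<bar>y - a\<bar> + 1 \<le> H" for x y
  proof (cases "odd (x + y)")
    case True
    with square_edges_subset_strip[OF True that] assms(1) pred_zero_square[of "(x, y)" J]
    show ?thesis by auto
  qed simp
  {
    case 0
    then show ?case using sq[of y x] by simp
  next
    case (Suc n)
    have "Measurable.pred (cost_space J) (\<lambda>c. (odd (x + y) \<and> zero_square c (x, y)) \<and>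
        (reach s n c (x + s, y + 1) \<or> reach s n c (x + s, y - 1)))"
      using Suc.prems by (intro pred_intros_logic sq Suc.IH) auto
    then show ?case by (simp only: reach.simps conj_assoc)
  }
qed

text \<open>Increasing in the bound \<open>m\<close> on the starting height and decreasing in the
  horizon \<open>n\<close>, so that a zero path is a union over \<open>m\<close> of intersections
  over \<open>n\<close>.\<close>

definition reach_both :: "nat \<Rightarrow> nat \<Rightarrow> (edge \<Rightarrow> real) \<Rightarrow> bool" where
  "reach_both m n c \<longleftrightarrow> (\<exists>k\<in>{- int m..int m}. reach 1 n c (0, k) \<and> reach (-1) n c (0, k))"

lemma reach_both_antimono: "n \<le> n' \<Longrightarrow> reach_both m n' c \<Longrightarrow> reach_both m n c"
  unfolding reach_both_def using reach_antimono by blast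

lemma reach_both_mono: "m \<le> m' \<Longrightarrow> reach_both m n c \<Longrightarrow> reach_both m' n c"
  unfolding reach_both_def by (elim bexE) (rule bexI, auto)

text \<open>Compactness: there are finitely many starting heights, so if each failed at some
  horizon, all would fail at the largest of these.\<close>

lemma reach_both_forever:
  assumes "\<forall>n. reach_both m n c"
  shows "\<exists>k\<in>{- int m..int m}. \<forall>n. reach 1 n c (0, k) \<and> reach (-1) n c (0, k)"
proof (rule ccontr)
  assume "\<not> ?thesis"
  then obtain f where f: "\<And>k. k \<in> {- int m..int m} \<Longrightarrow>
      \<not> (reach 1 (f k) c (0, k) \<and> reach (-1) (f k) c (0, k))" by metis
  define M where "M = Max (f ` {- int m..int m})"
  obtain k where k: "k \<in> {- int m..int m}" "reach 1 M c (0, k)" "reach (-1) M c (0, k)"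
    using assms[rule_format, of M] unfolding reach_both_def by blast
  have "f k \<le> M" unfolding M_def using k(1) by (intro Max_ge) auto
  with k f show False using reach_antimono by blast
qed

lemma ex_zero_path_iff_reach_both: "(\<exists>y. zero_path c y) \<longleftrightarrow> (\<exists>m. \<forall>n. reach_both m n c)"
proof
  assume "\<exists>y. zero_path c y"
  then obtain k where "\<forall>n. reach 1 n c (0, k) \<and> reach (-1) n c (0, k)"
    unfolding ex_zero_path_iff by blast
  then have "\<forall>n. reach_both (nat \<bar>k\<bar>) n c"
    unfolding reach_both_def by (intro allI bexI[of _ k]) auto
  then show "\<exists>m. \<forall>n. reach_both m n c" by blast
next
  assume "\<exists>m. \<forall>n. reach_both m n c"
  then show "\<exists>y. zero_path c y"
    unfolding ex_zero_path_iff using reach_both_forever by blast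
qed

lemma reach_shift: "reach s n (shift_costs K c) (x, y) \<longleftrightarrow> reach s n c (x, y + 2 * K)"
proof (induction n arbitrary: x y)
  have sq: "odd (x + y) \<and> zero_square (shift_costs K c) (x, y) \<longleftrightarrow>
      odd (x + (y + 2 * K)) \<and> zero_square c (x, y + 2 * K)" for x y
  proof (cases "odd (x + y)")
    case True
    have "square_edges (x, y + 2 * K) = (`) (shift K) ` square_edges (x, y)"
      by (simp add: square_edges_def shift_def algebra_simps)
    then show ?thesis
      using True square_edges_subset[OF True] by (auto simp: zero_square_def shift_costs_def)
  qed simp
  {
    case 0
    show ?case using sq[of x y] by simp
  next
    case (Suc n)
    show ?case using sq[of x y] Suc[of "x + s" "y + 1"] Suc[of "x + s" "y - 1"]
      by (auto simp: algebra_simps)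
  }
qed

lemma ex_zero_path_shift: "(\<exists>y. zero_path (shift_costs K c) y) \<longleftrightarrow> (\<exists>y. zero_path c y)"
  unfolding ex_zero_path_iff reach_shift
proof
  assume "\<exists>k. \<forall>n. reach 1 n c (0, k) \<and> reach (- 1) n c (0, k)"
  then obtain k where "\<forall>n. reach 1 n c (0, k) \<and> reach (- 1) n c (0, k)" by blast
  then show "\<exists>k. \<forall>n. reach 1 n c (0, k + 2 * K) \<and> reach (- 1) n c (0, k + 2 * K)"
    by (intro exI[of _ "k - 2 * K"]) simp
qed blast

lemma pred_reach_both:
  assumes "strip 0 (int m + int n + 1) \<subseteq> J"
  shows "Measurable.pred (cost_space J) (\<lambda>c. reach_both m n c)"
  unfolding reach_both_def
  using assms by (intro pred_intros_finite pred_intros_logic pred_reach[of 0 "int m + int n + 1"]) auto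

lemma pred_reach_both_shift:
  assumes "strip (2 * K) (int m + int n + 1) \<subseteq> J"
  shows "Measurable.pred (cost_space J) (\<lambda>c. reach_both m n (shift_costs K c))"
  unfolding reach_both_def reach_shift
  using assms by (intro pred_intros_finite pred_intros_logic pred_reach[of "2 * K" "int m + int n + 1"]) auto

lemma pred_ex_zero_path: "Measurable.pred (cost_space edges) (\<lambda>c. \<exists>y. zero_path c y)"
  unfolding ex_zero_path_iff_reach_both
  by (intro pred_intros_countable pred_reach_both) (auto simp: strip_def)

lemma sets_cost_law_Collect:
  "Measurable.pred (cost_space edges) P \<Longrightarrow> {c \<in> space (cost_law p). P c} \<in> sets (cost_law p)"
  unfolding pred_def sets_cost_law by (simp add: space_cost_law space_PiM PiE_def)

lemma measure_shift:
  assumes "Measurable.pred (cost_space edges) P"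
  shows "measure (cost_law p) {c \<in> space (cost_law p). P (shift_costs K c)} =
    measure (cost_law p) {c \<in> space (cost_law p). P c}"
    and "{c \<in> space (cost_law p). P (shift_costs K c)} \<in> sets (cost_law p)"
proof -
  have m: "shift_costs K \<in> measurable (cost_law p) (cost_law p)"
    unfolding cost_law_def shift_costs_def
    by (intro measurable_restrict measurable_component_singleton shift_edges)
  have eq: "shift_costs K -` {c \<in> space (cost_law p). P c} \<inter> space (cost_law p) =
      {c \<in> space (cost_law p). P (shift_costs K c)}"
    by (auto simp: space_cost_law shift_costs_def)
  show "{c \<in> space (cost_law p). P (shift_costs K c)} \<in> sets (cost_law p)"
    using measurable_sets[OF m sets_cost_law_Collect[OF assms]] eq by simp
  show "measure (cost_law p) {c \<in> space (cost_law p). P (shift_costs K c)} =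
    measure (cost_law p) {c \<in> space (cost_law p). P c}"
    using measure_distr[OF m sets_cost_law_Collect[OF assms]] eq distr_shift_costs by simp
qed

text \<open>The restrictions of the costs to disjoint sets of edges are independent, and invariance
  under restriction makes each event a preimage under one of them.\<close>

lemma measure_cost_law_indep:
  assumes ST: "S \<inter> T = {}" "S \<subseteq> edges" "T \<subseteq> edges"
    and P: "Measurable.pred (cost_space S) P" "\<And>c. P (restrict c S) = P c"
    and Q: "Measurable.pred (cost_space T) Q" "\<And>c. Q (restrict c T) = Q c"
  shows "measure (cost_law p) {c \<in> space (cost_law p). P c \<and> Q c} =
    measure (cost_law p) {c \<in> space (cost_law p). P c} *
    measure (cost_law p) {c \<in> space (cost_law p). Q c}"
proof -
  interpret prob_space "cost_law p" by (rule prob_space_cost_law)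
  let ?M = "\<lambda>_::edge. measure_pmf (coin p)"
  have "indep_vars ?M (\<lambda>e c. c e) edges"
    unfolding cost_law_def using edges_nonempty
    by (intro indep_vars_PiM_coordinates prob_space_measure_pmf)
  from indep_var_restrict[OF this ST]
  have ind: "indep_var (PiM S ?M) (\<lambda>c. restrict c S) (PiM T ?M) (\<lambda>c. restrict c T)" by simp
  have sets: "{c \<in> space (PiM S ?M). P c} \<in> sets (PiM S ?M)"
    if "Measurable.pred (cost_space S) P" for S P
  proof -
    have "sets (PiM S ?M) = sets (cost_space S)" by (intro sets_PiM_cong) simp_all
    moreover from sets_eq_imp_space_eq[OF this] have "space (PiM S ?M) = space (cost_space S)" .
    ultimately show ?thesis using that by (simp add: pred_def)
  qed
  have "(\<lambda>c. (restrict c S, restrict c T)) -`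
      ({c \<in> space (PiM S ?M). P c} \<times> {c \<in> space (PiM T ?M). Q c}) \<inter> space (cost_law p) =
      {c \<in> space (cost_law p). P c \<and> Q c}"
    "(\<lambda>c. restrict c S) -` {c \<in> space (PiM S ?M). P c} \<inter> space (cost_law p) = {c \<in> space (cost_law p). P c}"
    "(\<lambda>c. restrict c T) -` {c \<in> space (PiM T ?M). Q c} \<inter> space (cost_law p) = {c \<in> space (cost_law p). Q c}"
    by (auto simp: P(2) Q(2) space_PiM)
  with indep_varD[OF ind sets[OF P(1)] sets[OF Q(1)]] show ?thesis by simp
qed

text \<open>Crossings of a box approximate the shift-invariant event that a zero path exists, and a box
  is independent of its image under a large vertical shift.\<close>
lemma zero_path_0_1_law:
  assumes "measure (cost_law p) {c \<in> space (cost_law p). \<exists>y. zero_path c y} > 0"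
  shows "AE c in cost_law p. \<exists>y. zero_path c y"
proof -
  interpret prob_space "cost_law p" by (rule prob_space_cost_law)
  let ?Pr = "\<lambda>P. prob {c \<in> space (cost_law p). P c}"
  define A where "A c \<longleftrightarrow> (\<exists>y. zero_path c y)" for c
  define G where "G m c \<longleftrightarrow> (\<forall>n. reach_both m n c)" for m c
  have strip_edges: "strip b H \<subseteq> edges" for b H by (auto simp: strip_def)
  have A_iff: "A c \<longleftrightarrow> (\<exists>m. G m c)" for c
    unfolding A_def G_def by (rule ex_zero_path_iff_reach_both)
  have pred_A: "Measurable.pred (cost_space edges) A"
    unfolding A_def by (rule pred_ex_zero_path)
  have pred_R: "Measurable.pred (cost_space edges) (reach_both m n)" for m n
    using pred_reach_both[OF strip_edges] .
  have pred_G: "Measurable.pred (cost_space edges) (G m)" for m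
    unfolding G_def by (intro pred_intros_countable pred_R)
  have lim_R: "(\<lambda>n. ?Pr (reach_both m n)) \<longlonglongrightarrow> ?Pr (G m)" for m
  proof -
    have "(\<Inter>n. {c \<in> space (cost_law p). reach_both m n c}) = {c \<in> space (cost_law p). G m c}"
      by (auto simp: G_def)
    moreover have "decseq (\<lambda>n. {c \<in> space (cost_law p). reach_both m n c})"
      using reach_both_antimono by (auto simp: decseq_def)
    moreover have "range (\<lambda>n. {c \<in> space (cost_law p). reach_both m n c}) \<subseteq> events"
      using sets_cost_law_Collect[OF pred_R] by blast
    ultimately show ?thesis
      using finite_Lim_measure_decseq[of "\<lambda>n. {c \<in> space (cost_law p). reach_both m n c}"] by simp
  qed
  have lim_G: "(\<lambda>m. ?Pr (G m)) \<longlonglongrightarrow> ?Pr A"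
  proof -
    have "(\<Union>m. {c \<in> space (cost_law p). G m c}) = {c \<in> space (cost_law p). A c}"
      by (auto simp: A_iff)
    moreover have "incseq (\<lambda>m. {c \<in> space (cost_law p). G m c})"
      using reach_both_mono by (auto simp: incseq_def G_def)
    moreover have "range (\<lambda>m. {c \<in> space (cost_law p). G m c}) \<subseteq> events"
      using sets_cost_law_Collect[OF pred_G] by blast
    ultimately show ?thesis
      using finite_Lim_measure_incseq[of "\<lambda>m. {c \<in> space (cost_law p). G m c}"] by simp
  qed
  \<comment> \<open>Inclusion-exclusion for \<open>G m\<close> and its shift: they have equal
    probability and lie in the shift-invariant event \<open>A\<close>, while their intersection lies
    in two independent copies of \<open>reach_both m n\<close>.\<close>
  have box: "2 * ?Pr (G m) - ?Pr A \<le> (?Pr (reach_both m n))\<^sup>2" for m n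
  proof -
    \<comment> \<open>Start at most \<open>m\<close>, drift at most \<open>n\<close>, plus 1 for the
      corners. The shift is by \<open>2 * K = 2 * H + 2\<close>, so the strips occupy heights from
      \<open>-H\<close> to \<open>H\<close> and from \<open>H + 2\<close> to
      \<open>3 * H + 2\<close>.\<close>
    define H where "H = int m + int n + 1"
    define K where "K = H + 1"
    let ?G = "{c \<in> space (cost_law p). G m c}"
    let ?G' = "{c \<in> space (cost_law p). G m (shift_costs K c)}"
    have events: "?G \<in> events" "?G' \<in> events"
      using sets_cost_law_Collect[OF pred_G] measure_shift(2)[OF pred_G] by auto
    have "?G \<union> ?G' \<subseteq> {c \<in> space (cost_law p). A c}"
      using A_iff ex_zero_path_shift unfolding A_def by blast
    then have "prob (?G \<union> ?G') \<le> ?Pr A"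
      by (intro finite_measure_mono sets_cost_law_Collect pred_A)
    moreover have "prob (?G \<union> ?G') = prob ?G + prob ?G' - prob (?G \<inter> ?G')"
      using events by (intro measure_Un3) (auto simp: fmeasurable_eq_sets)
    moreover have "prob ?G' = prob ?G" by (rule measure_shift(1)[OF pred_G])
    moreover have "prob (?G \<inter> ?G') \<le> ?Pr (\<lambda>c. reach_both m n c \<and> reach_both m n (shift_costs K c))"
    proof (rule finite_measure_mono)
      show "{c \<in> space (cost_law p). reach_both m n c \<and> reach_both m n (shift_costs K c)} \<in> events"
        using pred_reach_both[OF strip_edges] pred_reach_both_shift[OF strip_edges]
        by (intro sets_cost_law_Collect pred_intros_logic)
    qed (auto simp: G_def)
    moreover have "?Pr (\<lambda>c. reach_both m n c \<and> reach_both m n (shift_costs K c)) =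
        ?Pr (reach_both m n) * ?Pr (\<lambda>c. reach_both m n (shift_costs K c))"
    proof (rule measure_cost_law_indep[of "strip 0 H" "strip (2 * K) H"])
      have "e \<notin> strip (2 * K) H" if e: "e \<in> strip 0 H" for e
      proof
        assume e': "e \<in> strip (2 * K) H"
        obtain q where "q \<in> e" using e unfolding strip_def edges_def by blast
        with e e' have "\<bar>snd q\<bar> \<le> H" "\<bar>snd q - 2 * K\<bar> \<le> H" by (auto simp: strip_def)
        then show False by (simp add: K_def)
      qed
      then show "strip 0 H \<inter> strip (2 * K) H = {}" by blast
      show "reach_both m n (restrict c (strip 0 H)) = reach_both m n c" for c
        unfolding reach_both_def
        by (intro bex_cong refl arg_cong2[of _ _ _ _ "(\<and>)"] reach_cong[of 0 H]) (auto simp: H_def)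
      show "reach_both m n (shift_costs K (restrict c (strip (2 * K) H))) = reach_both m n (shift_costs K c)" for c
        unfolding reach_both_def reach_shift
        by (intro bex_cong refl arg_cong2[of _ _ _ _ "(\<and>)"] reach_cong[of "2 * K" H]) (auto simp: H_def)
    qed (auto intro!: pred_reach_both pred_reach_both_shift strip_edges simp: H_def)
    moreover have "?Pr (\<lambda>c. reach_both m n (shift_costs K c)) = ?Pr (reach_both m n)"
      by (rule measure_shift(1)[OF pred_R])
    ultimately show ?thesis by (simp add: power2_eq_square)
  qed
  \<comment> \<open>Letting \<open>n\<close> and then \<open>m\<close> tend to infinity turns the
    bound into \<open>a \<le> a * a\<close> for the probability \<open>a\<close> of
    \<open>A\<close>; since \<open>a\<close> is positive, it equals 1.\<close>
  have "2 * ?Pr (G m) - ?Pr A \<le> (?Pr (G m))\<^sup>2" for m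
    by (rule LIMSEQ_le_const[OF tendsto_power[OF lim_R[of m]]]) (use box in blast)
  then have "2 * ?Pr A - ?Pr A \<le> (?Pr A)\<^sup>2"
    by (intro LIMSEQ_le[OF tendsto_diff[OF tendsto_mult[OF tendsto_const lim_G] tendsto_const]
          tendsto_power[OF lim_G]]) blast
  then have "?Pr A * 1 \<le> ?Pr A * ?Pr A" by (simp add: power2_eq_square)
  moreover have "?Pr A > 0" using assms unfolding A_def .
  ultimately have "1 \<le> ?Pr A" by (simp only: mult_le_cancel_left_pos)
  then have "?Pr A = 1" using prob_le_1 by (intro antisym)
  then show ?thesis
    using prob_Collect_eq_1[OF sets_cost_law_Collect[OF pred_A]] by (simp add: A_def)
qed

section \<open>Almost sure properties of the costs and the conclusion\<close>

lemma AE_cost_law_component: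
  assumes "\<And>x. x \<in> set_pmf (coin p) \<Longrightarrow> P x"
  shows "AE c in cost_law p. \<forall>e\<in>edges. P (c e)"
  unfolding cost_law_def using assms
  by (intro AE_ball_countable' countable_edges AE_PiM_component prob_space_measure_pmf)
    (auto simp: AE_measure_pmf_iff)

lemma AE_cost_nonneg: "AE c in cost_law p. \<forall>e\<in>edges. 0 \<le> c e"
  by (rule AE_cost_law_component) auto

lemma AE_cost_zero: "AE c in cost_law 0. \<forall>e\<in>edges. c e = 0"
proof (rule AE_cost_law_component)
  have "True \<notin> set_pmf (bernoulli_pmf 0)" by (simp add: set_pmf_iff)
  then show "x = 0" if "x \<in> set_pmf (coin 0)" for x using that by (auto simp: of_bool_def)
qed

text \<open>The first \<open>n\<close> edges of the ray are distinct, so all have cost 0 with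
  probability \<open>(1 - p) ^ n\<close>, which tends to 0.\<close>

lemma AE_ray:
  assumes p: "0 < p" "p \<le> 1" and q: "q \<in> lattice" "\<bar>fst d\<bar> = 1" "\<bar>snd d\<bar> = 1"
  shows "AE c in cost_law p. \<exists>k. c (ray_edge q d k) \<noteq> 0"
proof -
  interpret prob_space "cost_law p" by (rule prob_space_cost_law)
  interpret P: product_prob_space "\<lambda>_. measure_pmf (coin p)" edges by unfold_locales
  have coin: "measure (measure_pmf (coin p)) {0} = 1 - p"
  proof -
    have "of_bool -` {0 :: real} = {False}" by auto
    then show ?thesis unfolding measure_map_pmf using p by (simp add: measure_pmf_single)
  qed
  let ?N = "{c \<in> space (cost_law p). \<forall>k. c (ray_edge q d k) = 0}"
  have pred: "Measurable.pred (cost_space edges) (\<lambda>c. c (ray_edge q d k) = 0)" for k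
    using ray_edge_in_edges[OF q, of k]
    by (intro measurable_compose[OF measurable_component_singleton[of _ edges "\<lambda>_. count_space UNIV"]]) auto
  have N: "?N \<in> events" by (intro sets_cost_law_Collect pred_intros_countable pred)
  have "prob ?N \<le> (1 - p) ^ n" for n
  proof -
    let ?J = "ray_edge q d ` {..<n}"
    let ?C = "{c \<in> space (cost_law p). \<forall>e\<in>?J. c e \<in> {0}}"
    have J: "?J \<subseteq> edges" using ray_edge_in_edges[OF q] by auto
    have "card ?J = n"
      using inj_on_subset[OF inj_ray_edge[OF q(2)]] by (subst card_image) auto
    then have "emeasure (cost_law p) ?C = ennreal ((1 - p) ^ n)"
      unfolding cost_law_def using P.emeasure_PiM_Collect[OF J, of "\<lambda>_. {0}"] p coin
      by (simp add: measure_pmf.emeasure_eq_measure ennreal_power)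
    then have "prob ?C = (1 - p) ^ n" using p by (simp add: measure_def)
    moreover have "prob ?N \<le> prob ?C"
    proof (rule finite_measure_mono)
      have "Measurable.pred (cost_space edges) (\<lambda>c. \<forall>k\<in>{..<n}. c (ray_edge q d k) = 0)"
        by (intro pred_intros_finite pred) auto
      from sets_cost_law_Collect[OF this] show "?C \<in> events" by simp
    qed auto
    ultimately show ?thesis by simp
  qed
  moreover have "(\<lambda>n. (1 - p) ^ n) \<longlonglongrightarrow> 0" using p by (intro LIMSEQ_realpow_zero) auto
  ultimately have "prob ?N \<le> 0" by (intro LIMSEQ_le_const) auto
  then have "prob ?N = 0" by (intro antisym measure_nonneg)
  with prob_Collect_eq_0[OF N] show ?thesis by simp
qed

lemma is_as_value_0:
  assumes p: "p \<in> {0..1}" "p < p_crit"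
  shows "is_as_value p 0"
proof (cases "p = 0")
  case True
  \<comment> \<open>For \<open>p = 0\<close> every ray has cost 0 and the argument excluding rays
    breaks down, but every play is free and any strategy of Player 1 will do.\<close>
  have "AE c in cost_law 0. \<forall>z\<in>lattice. has_value c z 0"
    using AE_cost_zero
  proof eventually_elim
    case (elim c)
    have "c (crossed_edge z undefined \<tau> m) = 0" if "z \<in> lattice" "m > 0" for z \<tau> m
      using elim crossed_edge_in_edges[OF that(1), of undefined \<tau> "m - 1"] that(2) by simp
    then show ?case using elim by (intro ballI has_value_0[where \<sigma> = undefined]) auto
  qed
  then show ?thesis by (simp add: True is_as_value_def)
next
  case False
  let ?S = "{p \<in> {0..1}. measure (cost_law p) {c \<in> space (cost_law p). \<exists>y. zero_path c y} > 0}"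
  \<comment> \<open>A zigzag witnesses that 0 belongs to \<open>?S\<close>. The set is thus
    nonempty, and \<open>p\<close> below its supremum yields a member \<open>p'\<close> above
    \<open>p\<close>.\<close>
  have "AE c in cost_law 0. \<exists>y. zero_path c y"
    using AE_cost_zero
  proof eventually_elim
    case (elim c)
    let ?y = "\<lambda>i::int. if even i then 1 else 0 :: int"
    have "odd (i + ?y i) \<and> \<bar>?y (i + 1) - ?y i\<bar> = 1 \<and> zero_square c (i, ?y i)" for i
      using square_edges_subset[of i "?y i"] elim by (auto simp: zero_square_def subset_iff)
    then show ?case unfolding zero_path_def by (intro exI[of _ ?y] allI)
  qed
  then have "measure (cost_law 0) {c \<in> space (cost_law 0). \<exists>y. zero_path c y} = 1"
    using prob_space.prob_Collect_eq_1[OF prob_space_cost_law sets_cost_law_Collect[OF pred_ex_zero_path]]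
    by blast
  then have "0 \<in> ?S" by simp
  then obtain p' where p': "p' \<in> ?S" "p < p'"
    using p(2) less_cSupD[of ?S p] unfolding p_crit_def by blast
  have "Measurable.pred (cost_space edges) (\<lambda>c. \<exists>y. zero_path c y)" by (rule pred_ex_zero_path)
  then have "measure (cost_law p') {c \<in> space (cost_law p'). \<exists>y. zero_path c y}
      \<le> measure (cost_law p) {c \<in> space (cost_law p). \<exists>y. zero_path c y}"
    using p p' by (intro measure_cost_law_antimono) (auto simp: pred_def intro: zero_path_mono)
  then have "AE c in cost_law p. \<exists>y. zero_path c y"
    using p' by (intro zero_path_0_1_law) auto
  \<comment> \<open>There are countably many starting points and directions, so one null set covers
    all rays.\<close>
  moreover have "AE c in cost_law p. \<forall>q d. q \<in> lattice \<and> \<bar>fst d\<bar> = 1 \<and> \<bar>snd d\<bar> = 1 \<longrightarrow>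
      (\<exists>k. c (ray_edge q d k) \<noteq> 0)"
    unfolding AE_all_countable
  proof (intro allI)
    fix q d :: "int \<times> int"
    show "AE c in cost_law p. q \<in> lattice \<and> \<bar>fst d\<bar> = 1 \<and> \<bar>snd d\<bar> = 1 \<longrightarrow> (\<exists>k. c (ray_edge q d k) \<noteq> 0)"
      using AE_ray[of p q d] p False
      by (cases "q \<in> lattice \<and> \<bar>fst d\<bar> = 1 \<and> \<bar>snd d\<bar> = 1") auto
  qed
  ultimately have "AE c in cost_law p. \<forall>z\<in>lattice. has_value c z 0"
    using AE_cost_nonneg
  proof eventually_elim
    case (elim c)
    then obtain Y where Y: "zero_path c Y" by blast
    show ?case
    proof
      fix z assume z: "z \<in> lattice"
      have "\<exists>N. \<forall>m>N. c (crossed_edge z (path_strategy Y z) \<tau> m) = 0" for \<tau>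
        using elim(2) by (intro path_strategy_eventually_zero[OF Y z]) blast
      then show "has_value c z 0"
        using elim(3) z by (intro has_value_0) blast+
    qed
  qed
  then show ?thesis by (simp add: is_as_value_def)
qed

text \<open>An equation between constants that holds almost surely in a probability space holds.
  This makes the description in \<open>as_value\<close> definite.\<close>

lemma is_as_value_unique:
  assumes "is_as_value p v" "is_as_value p w"
  shows "v = w"
proof -
  interpret prob_space "cost_law p" by (rule prob_space_cost_law)
  have "(0, 0) \<in> lattice" by (simp add: lattice_def)
  moreover have "AE c in cost_law p. \<forall>z\<in>lattice. has_value c z v \<and> has_value c z w"
    using assms unfolding is_as_value_def by auto
  ultimately have "AE c in cost_law p. v = w"
    using has_value_unique by (elim eventually_mono) blast
  then show ?thesis by simp
qed

theorem theorem7p1: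
  fixes p :: real
  assumes "p \<in> {0..1}" and "p < p_crit"
  shows "is_as_value p (as_value p) \<and> as_value p = 0"
proof -
  have 0: "is_as_value p 0" using assms by (rule is_as_value_0)
  then have "as_value p = 0"
    unfolding as_value_def using is_as_value_unique by (intro the_equality) blast+
  with 0 show ?thesis by simp
qed

end
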